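(* Let $(X_i)_{i\ge1}$ be i.i.d. random variables with values in $\{-1,0,1,2,\dots\}$, let $S_0=0$ and $S_k=X_1+\cdots+X_k$, and for $p\ge1$ let $T_p=\inf\{k\ge0:S_k=-p\}$ be the hitting time of $-p$ by $S$. Suppose that $S$ does not drift to $\infty$, i.e. that $T_1<\infty$ almost surely. Then for any nonnegative measurable function $f:\mathbb Z\to\mathbb R$ and any $p\ge2$, $$\mathbb E\left[\frac1{T_p-1}\sum_{i=1}^{T_p}f(X_i)\right]=\mathbb E\left[f(X_1)\,\frac p{p+X_1}\right].$$
   Context: Both sides take values in $[0,\infty]$. *)

theory Defs
  imports "HOL-Probability.Probability"
begin

definition walk :: "(nat \<Rightarrow> 'a \<Rightarrow> int) \<Rightarrow> nat \<Rightarrow> 'a \<Rightarrow> int" where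
  "walk X k \<omega> = (\<Sum>i=1..k. X i \<omega>)"

text \<open>The infimum is taken in \<^typ>\<open>enat\<close>, so it is \<open>\<infinity>\<close> if the level \<open>-p\<close> is never reached.\<close>

definition hitting_time :: "(nat \<Rightarrow> 'a \<Rightarrow> int) \<Rightarrow> nat \<Rightarrow> 'a \<Rightarrow> enat" where
  "hitting_time X p \<omega> = (INF k\<in>{k. walk X k \<omega> = - int p}. enat k)"

text \<open>Independent and identically distributed random variables indexed by \<open>i \<ge> 1\<close>; the value
  \<open>X 0\<close> is irrelevant. The integers carry the discrete sigma-algebra.\<close>

definition iid :: "'a measure \<Rightarrow> (nat \<Rightarrow> 'a \<Rightarrow> int) \<Rightarrow> bool" where
  "iid M X \<longleftrightarrow>
     prob_space.indep_vars M (\<lambda>_. count_space UNIV) X {1..} \<and>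
     (\<forall>i\<ge>1. distr M (count_space UNIV) (X i) = distr M (count_space UNIV) (X 1))"

text \<open>The quantity \<open>1 / (T - 1) * (f (X 1) + \<dots> + f (X T))\<close> with \<open>T = hitting_time X p\<close>.
  Where \<open>T = \<infinity>\<close> the index set is infinite and the value is 0 by convention; this matters only
  if \<open>T = \<infinity>\<close> has positive probability. For steps \<open>\<ge> -1\<close> one has \<open>T \<ge> p\<close>, so for \<open>p \<ge> 2\<close>
  the divisor is not zero.\<close>

definition hitting_average :: "(nat \<Rightarrow> 'a \<Rightarrow> int) \<Rightarrow> (int \<Rightarrow> real) \<Rightarrow> nat \<Rightarrow> 'a \<Rightarrow> ennreal" where
  "hitting_average X f p \<omega> =
     1 / (ennreal_of_enat (hitting_time X p \<omega>) - 1) *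
       (\<Sum>i | 1 \<le> i \<and> enat i \<le> hitting_time X p \<omega>. ennreal (f (X i \<omega>)))"

end

theory Submission imports Defs begin

text \<open>
  Write \<open>q\<close> for the law of a step and \<open>T\<^sub>k\<close> for the hitting time of \<open>-k\<close>. Whether \<open>T\<^sub>k = n\<close> depends
  only on the first \<open>n\<close> steps, so every expectation here is one over lists of \<open>n\<close> independent
  \<open>q\<close>-distributed steps.

  The main tool is a weighted form of Kemperman's formula. If \<open>F\<close> is a symmetric function of the
  first \<open>n\<close> steps, then
  \<open>n * E[F; T\<^sub>k = n] = k * E[F; S\<^sub>n = -k]\<close> (\<open>first_passage_ballot\<close>).
  It is proved by induction on \<open>n\<close>, for all \<open>k\<close> and \<open>F\<close> at once: conditioning on the first step
  and using the formula for \<open>n - 1\<close> steps from level \<open>k + X\<^sub>1\<close> gives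
  \<open>(n - 1) * E[F; T\<^sub>k = n] = E[(k + X\<^sub>1) * F; S\<^sub>n = -k]\<close>. By exchangeability the factor \<open>k + X\<^sub>1\<close>
  may be replaced by its average over the \<open>n\<close> coordinates, which on \<open>S\<^sub>n = -k\<close> equals
  \<open>k - k / n = (n - 1) * k / n\<close>.

  For the theorem, use this twice. With \<open>F = f(X\<^sub>1) + \<dots> + f(X\<^sub>n)\<close>, and exchangeability once more,
  \<open>E[F; T\<^sub>p = n] = p * E[f(X\<^sub>1); S\<^sub>n = -p]\<close>. Conditioning the right-hand side on \<open>X\<^sub>1 = x\<close> leaves the
  probability that \<open>n - 1\<close> steps sum to \<open>-(p + x)\<close>; by the formula with \<open>F = 1\<close>, this is
  \<open>(n - 1) / (p + x)\<close> times the probability that \<open>T\<close> at level \<open>p + x\<close> equals \<open>n - 1\<close>.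
  The factor \<open>n - 1\<close> cancels the normalisation \<open>1 / (T\<^sub>p - 1)\<close> (\<open>first_passage_average_at\<close>), and
  what remains is \<open>f(x) * p / (p + x)\<close> times the law of the hitting time of \<open>-(p + x)\<close>. Summing
  over \<open>n\<close> gives total mass 1, because the walk descends at most one level per step: it reaches
  \<open>-k\<close> by \<open>k\<close> successive independent descents of one level, each of which is almost surely finite
  (\<open>suminf_first_passage_prob\<close>).
\<close>

section \<open>First passage of a finite sequence of steps\<close>

text \<open>Says that the walk with the given steps reaches \<open>-k\<close> for the first time at the very end of the
  list. The recursion is the Markov property: after a step \<open>x\<close> the distance left is \<open>k + x\<close>.\<close>

primrec first_passage :: "int \<Rightarrow> int list \<Rightarrow> bool" where
  "first_passage k [] \<longleftrightarrow> k = 0"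
| "first_passage k (x # xs) \<longleftrightarrow> k \<noteq> 0 \<and> first_passage (k + x) xs"

lemma first_passage_iff:
  "first_passage k xs \<longleftrightarrow>
     sum_list xs = - k \<and> (\<forall>j < length xs. sum_list (take j xs) \<noteq> - k)"
proof (induction xs arbitrary: k)
  case Nil
  then show ?case by auto
next
  case (Cons x xs)
  have "(\<forall>j < length (x # xs). sum_list (take j (x # xs)) \<noteq> - k) \<longleftrightarrow>
        k \<noteq> 0 \<and> (\<forall>j < length xs. x + sum_list (take j xs) \<noteq> - k)"
    by (simp only: length_Cons All_less_Suc2) auto
  moreover have "x + s = - k \<longleftrightarrow> s = - (k + x)" for s
    by auto
  ultimately show ?case
    using Cons.IH[of "k + x"] by auto
qed

section \<open>Exchangeability of independent samples\<close>

lemma nn_integral_replicate_pmf_rotate: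
  fixes F :: "'b list \<Rightarrow> ennreal"
  shows "(\<integral>\<^sup>+xs. F (rotate i xs) \<partial>replicate_pmf n q) = (\<integral>\<^sup>+xs. F xs \<partial>replicate_pmf n q)"
proof (induction i arbitrary: F)
  case (Suc i)
  have "map_pmf rotate1 (replicate_pmf n q) = replicate_pmf n q"
  proof (cases n)
    case (Suc m)
    have "replicate_pmf n q = replicate_pmf (m + 1) q"
      using Suc by simp
    also have "\<dots> = bind_pmf (replicate_pmf m q) (\<lambda>xs. bind_pmf q (\<lambda>x. return_pmf (xs @ [x])))"
      unfolding replicate_pmf_distrib replicate_pmf_1 by (simp add: map_pmf_def bind_assoc_pmf bind_return_pmf)
    also have "\<dots> = bind_pmf q (\<lambda>x. bind_pmf (replicate_pmf m q) (\<lambda>xs. return_pmf (xs @ [x])))"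
      by (rule bind_commute_pmf)
    also have "\<dots> = map_pmf rotate1 (replicate_pmf n q)"
      using Suc by (simp add: map_pmf_def bind_assoc_pmf bind_return_pmf)
    finally show ?thesis ..
  qed simp
  then have "(\<integral>\<^sup>+xs. F (rotate i (rotate1 xs)) \<partial>replicate_pmf n q) = (\<integral>\<^sup>+xs. F (rotate i xs) \<partial>replicate_pmf n q)"
    using nn_integral_map_pmf[where f = "\<lambda>xs. F (rotate i xs)" and g = rotate1 and M = "replicate_pmf n q"]
    by (simp only:)
  with Suc.IH show ?case
    by (simp add: rotate1_rotate_swap)
qed simp

lemma mset_rotate:
  fixes xs :: "'a list"
  shows "mset (rotate i xs) = mset xs"
proof (induction i)
  case (Suc i)
  have "mset (rotate1 ys) = mset ys" for ys :: "'a list"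
    by (cases ys) simp_all
  with Suc show ?case
    by simp
qed simp

text \<open>Against a symmetric weight all coordinates of the sample have the same expectation, so the
  first one (the \<open>x\<close> that is sampled separately on the left) stands for their average. A rotation
  brings each coordinate to the front.\<close>

lemma nn_integral_replicate_pmf_exchangeable:
  fixes q :: "'b pmf" and g :: "'b \<Rightarrow> ennreal" and G :: "'b multiset \<Rightarrow> ennreal"
  shows "of_nat (Suc n) * (\<integral>\<^sup>+x. \<integral>\<^sup>+xs. g x * G (add_mset x (mset xs)) \<partial>replicate_pmf n q \<partial>q) =
         (\<integral>\<^sup>+xs. sum_list (map g xs) * G (mset xs) \<partial>replicate_pmf (Suc n) q)"
proof -
  let ?R = "replicate_pmf (Suc n) q"
  have len: "length xs = Suc n" if "xs \<in> set_pmf ?R" for xs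
    using that unfolding set_replicate_pmf by simp
  have "(\<integral>\<^sup>+xs. sum_list (map g xs) * G (mset xs) \<partial>?R) =
        (\<integral>\<^sup>+xs. (\<Sum>i<Suc n. g (xs ! i) * G (mset xs)) \<partial>?R)"
    by (intro nn_integral_cong_AE AE_pmfI)
       (simp add: len sum_list_sum_nth sum_distrib_right atLeast0LessThan del: replicate_pmf.simps sum.lessThan_Suc)
  also have "\<dots> = (\<Sum>i<Suc n. \<integral>\<^sup>+xs. g (xs ! i) * G (mset xs) \<partial>?R)"
    by (rule nn_integral_sum) simp
  also have "\<dots> = (\<Sum>i<Suc n. \<integral>\<^sup>+xs. g (hd xs) * G (mset xs) \<partial>?R)"
  proof (rule sum.cong[OF refl])
    fix i assume i: "i \<in> {..<Suc n}"
    have "(\<integral>\<^sup>+xs. g (xs ! i) * G (mset xs) \<partial>?R) =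
          (\<integral>\<^sup>+xs. g (hd (rotate i xs)) * G (mset (rotate i xs)) \<partial>?R)"
    proof (intro nn_integral_cong_AE AE_pmfI)
      fix xs assume "xs \<in> set_pmf ?R"
      then have l: "length xs = Suc n" by (rule len)
      then have "hd (rotate i xs) = xs ! i"
        using i by (subst hd_rotate_conv_nth) auto
      then show "g (xs ! i) * G (mset xs) = g (hd (rotate i xs)) * G (mset (rotate i xs))"
        by (simp add: mset_rotate)
    qed
    also have "\<dots> = (\<integral>\<^sup>+xs. g (hd xs) * G (mset xs) \<partial>?R)"
      by (rule nn_integral_replicate_pmf_rotate)
    finally show "(\<integral>\<^sup>+xs. g (xs ! i) * G (mset xs) \<partial>?R) = (\<integral>\<^sup>+xs. g (hd xs) * G (mset xs) \<partial>?R)" .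
  qed
  finally show ?thesis
    by simp
qed

section \<open>The weighted Kemperman formula\<close>

text \<open>Taking \<open>F\<close> to be a function of the multiset of steps encodes its symmetry in such a way that
  fixing the first step leaves a function of the same kind, as the induction requires. The bound
  \<open>-1\<close> on the steps keeps the remaining level \<open>k + x\<close> nonnegative as long as \<open>k > 0\<close>, so that all
  quantities can be computed in \<open>ennreal\<close>.\<close>

lemma first_passage_ballot:
  fixes q :: "int pmf" and F :: "int multiset \<Rightarrow> ennreal"
  assumes q: "set_pmf q \<subseteq> {-1..}" and k: "k \<ge> 0"
  shows "of_nat n * (\<integral>\<^sup>+xs. F (mset xs) * of_bool (first_passage k xs) \<partial>replicate_pmf n q) =
         ennreal (of_int k) * (\<integral>\<^sup>+xs. F (mset xs) * of_bool (sum_list xs = - k) \<partial>replicate_pmf n q)"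
  using k
proof (induction n arbitrary: k F)
  case 0
  then show ?case by (cases "k = 0") auto
next
  case (Suc n)
  show ?case
  proof (cases "k = 0")
    case True
    then show ?thesis by simp
  next
    case False
    then have k: "k \<ge> 1" using Suc.prems by simp
    let ?A = "\<lambda>x. \<integral>\<^sup>+xs. F (add_mset x (mset xs)) * of_bool (first_passage (k + x) xs) \<partial>replicate_pmf n q"
    have step: "(\<integral>\<^sup>+xs. F (mset xs) * of_bool (first_passage k xs) \<partial>replicate_pmf (Suc n) q) = (\<integral>\<^sup>+x. ?A x \<partial>q)"
      using False by simp
    show ?thesis
    (* Fixing the first step gives the formula multiplied by n, so n = 0 is treated separately. *)
    proof (cases "n = 0")
      case True
      show ?thesis
      proof (cases "k = 1")
        case True
        have "1 + x = 0 \<longleftrightarrow> x = -1" for x :: int by auto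
        with True \<open>n = 0\<close> show ?thesis by simp
      next
        case False
        then have "of_bool (x = - k) = (0 :: ennreal)" "of_bool (k + x = 0) = (0 :: ennreal)"
          if "x \<in> set_pmf q" for x
          using q k that by fastforce+
        then have "(\<integral>\<^sup>+x. F {#x#} * of_bool (k + x = 0) \<partial>q) = (\<integral>\<^sup>+x. 0 \<partial>q)"
          "(\<integral>\<^sup>+x. F {#x#} * of_bool (x = - k) \<partial>q) = (\<integral>\<^sup>+x. 0 \<partial>q)"
          by (intro nn_integral_cong_AE AE_pmfI; simp)+
        then show ?thesis using \<open>n = 0\<close> k by simp
      qed
    next
      case n: False
      let ?g = "\<lambda>x. ennreal (of_int (k + x))"
      let ?G = "\<lambda>N. F N * of_bool (sum_mset N = - k)"
      have "of_nat n * (of_nat (Suc n) * (\<integral>\<^sup>+x. ?A x \<partial>q)) = of_nat (Suc n) * (\<integral>\<^sup>+x. of_nat n * ?A x \<partial>q)"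
        by (simp add: nn_integral_cmult mult.left_commute)
      also have "(\<integral>\<^sup>+x. of_nat n * ?A x \<partial>q) =
          (\<integral>\<^sup>+x. \<integral>\<^sup>+xs. ?g x * ?G (add_mset x (mset xs)) \<partial>replicate_pmf n q \<partial>q)"
      proof (intro nn_integral_cong_AE AE_pmfI)
        fix x assume "x \<in> set_pmf q"
        then have "k + x \<ge> 0" using q k by fastforce
        then have "of_nat n * ?A x = ?g x *
            (\<integral>\<^sup>+xs. F (add_mset x (mset xs)) * of_bool (sum_list xs = - (k + x)) \<partial>replicate_pmf n q)"
          by (rule Suc.IH)
        also have "\<dots> = (\<integral>\<^sup>+xs. ?g x * (F (add_mset x (mset xs)) * of_bool (sum_list xs = - (k + x))) \<partial>replicate_pmf n q)"
          by (simp add: nn_integral_cmult)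
        also have "\<dots> = (\<integral>\<^sup>+xs. ?g x * ?G (add_mset x (mset xs)) \<partial>replicate_pmf n q)"
        proof (rule nn_integral_cong)
          fix xs :: "int list"
          have "sum_list xs = - (k + x) \<longleftrightarrow> x + sum_list xs = - k" by auto
          then show "?g x * (F (add_mset x (mset xs)) * of_bool (sum_list xs = - (k + x))) = ?g x * ?G (add_mset x (mset xs))"
            by (simp add: sum_mset_sum_list)
        qed
        finally show "of_nat n * ?A x = (\<integral>\<^sup>+xs. ?g x * ?G (add_mset x (mset xs)) \<partial>replicate_pmf n q)" .
      qed
      also have "of_nat (Suc n) * \<dots> = (\<integral>\<^sup>+xs. sum_list (map ?g xs) * ?G (mset xs) \<partial>replicate_pmf (Suc n) q)"
        by (rule nn_integral_replicate_pmf_exchangeable)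
      also have "\<dots> = (\<integral>\<^sup>+xs. of_nat n * (ennreal (of_int k) * (F (mset xs) * of_bool (sum_list xs = - k))) \<partial>replicate_pmf (Suc n) q)"
      proof (intro nn_integral_cong_AE AE_pmfI)
        fix xs assume "xs \<in> set_pmf (replicate_pmf (Suc n) q)"
        then have xs: "set xs \<subseteq> set_pmf q" "length xs = Suc n"
          unfolding set_replicate_pmf by auto
        have "0 \<le> k + x" if "x \<in> set xs" for x
          using xs(1) q k that by fastforce
        then have "sum_list (map ?g xs) = ennreal (of_int (\<Sum>x\<leftarrow>xs. k + x))"
        proof (induction xs)
          case (Cons x xs)
          have "0 \<le> (\<Sum>x\<leftarrow>xs. k + x)"
            by (rule sum_list_nonneg) (use Cons.prems in auto)
          moreover have "0 \<le> k + x"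
            using Cons.prems by simp
          ultimately show ?case
            using Cons by (simp del: of_int_add add: of_int_add[of "k + x"])
        qed simp
        also have "(\<Sum>x\<leftarrow>xs. k + x) = int (Suc n) * k + sum_list xs"
          using xs(2) by (simp add: sum_list_addf sum_list_triv)
        finally have g: "sum_list (map ?g xs) = ennreal (of_int (int (Suc n) * k + sum_list xs))" .
        have "ennreal (of_int (int (Suc n) * k + sum_list xs)) = of_nat n * ennreal (of_int k)"
          if "sum_list xs = - k"
        proof -
          have "int (Suc n) * k + sum_list xs = int n * k"
            using that by (simp add: algebra_simps)
          then show ?thesis
            using k by (simp add: ennreal_mult ennreal_of_nat_eq_real_of_nat)
        qed
        with g show "sum_list (map ?g xs) * ?G (mset xs) =
           of_nat n * (ennreal (of_int k) * (F (mset xs) * of_bool (sum_list xs = - k)))"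
          by (simp add: sum_mset_sum_list mult.assoc)
      qed
      also have "\<dots> = of_nat n * (ennreal (of_int k) * (\<integral>\<^sup>+xs. F (mset xs) * of_bool (sum_list xs = - k) \<partial>replicate_pmf (Suc n) q))"
        by (simp add: nn_integral_cmult del: replicate_pmf.simps)
      finally show ?thesis
        using n unfolding step by (simp add: ennreal_mult_cancel_left del: replicate_pmf.simps of_nat_Suc)
    qed
  qed
qed

section \<open>Every negative level is reached\<close>

lemma suminf_convolution_ennreal:
  fixes a b :: "nat \<Rightarrow> ennreal"
  shows "(\<Sum>m. \<Sum>i\<le>m. a i * b (m - i)) = (\<Sum>i. a i) * (\<Sum>j. b j)"
proof -
  have "(\<Sum>m. \<Sum>i\<le>m. a i * b (m - i)) = (\<Sum>m. \<Sum>i. if i \<le> m then a i * b (m - i) else 0)"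
    by (intro suminf_cong) (subst suminf_finite[of "{.._}"], auto)
  also have "\<dots> = (\<Sum>i. \<Sum>m. if i \<le> m then a i * b (m - i) else 0)"
    using nn_integral_suminf[of "\<lambda>m i. if i \<le> m then a i * b (m - i) else 0" "count_space UNIV"]
    by (simp add: nn_integral_count_space_nat)
  also have "\<dots> = (\<Sum>i. a i * (\<Sum>j. b j))"
  proof (intro suminf_cong)
    fix i
    let ?c = "\<lambda>m. if i \<le> m then a i * b (m - i) else 0"
    have "(\<Sum>m. ?c m) = (\<Sum>m. ?c (m + i)) + (\<Sum>m<i. ?c m)"
      by (rule suminf_offset) simp
    then show "(\<Sum>m. ?c m) = a i * (\<Sum>j. b j)"
      by simp
  qed
  finally show ?thesis
    by simp
qed

definition first_passage_prob :: "int pmf \<Rightarrow> int \<Rightarrow> nat \<Rightarrow> ennreal" where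
  "first_passage_prob q k n = (\<integral>\<^sup>+xs. of_bool (first_passage k xs) \<partial>replicate_pmf n q)"

lemma first_passage_prob_0 [simp]: "first_passage_prob q k 0 = of_bool (k = 0)"
  by (simp add: first_passage_prob_def)

lemma first_passage_prob_Suc:
  "first_passage_prob q k (Suc n) =
     (if k = 0 then 0 else \<integral>\<^sup>+x. first_passage_prob q (k + x) n \<partial>q)"
  by (simp add: first_passage_prob_def)

text \<open>The strong Markov property: a walk that descends at most one level per step passes through \<open>-k\<close> on its way to
  \<open>-(k + 1)\<close>, and then has to descend one further level. In this discrete form it follows by
  conditioning on the first step.\<close>

lemma first_passage_prob_add_one:
  assumes q: "set_pmf q \<subseteq> {-1..}" and k: "k \<ge> 0"
  shows "first_passage_prob q (k + 1) m =
           (\<Sum>i\<le>m. first_passage_prob q k i * first_passage_prob q 1 (m - i))"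
  using k
proof (induction m arbitrary: k)
  case 0
  then show ?case by simp
next
  case (Suc m)
  show ?case
  proof (cases "k = 0")
    case True
    then show ?thesis
      by (subst sum.atMost_Suc_shift) (simp add: first_passage_prob_Suc)
  next
    case False
    have "first_passage_prob q (k + 1) (Suc m) = (\<integral>\<^sup>+x. first_passage_prob q (k + x + 1) m \<partial>q)"
      using Suc.prems by (simp add: first_passage_prob_Suc ac_simps)
    also have "\<dots> = (\<integral>\<^sup>+x. (\<Sum>i\<le>m. first_passage_prob q (k + x) i * first_passage_prob q 1 (m - i)) \<partial>q)"
    proof (intro nn_integral_cong_AE AE_pmfI)
      fix x assume "x \<in> set_pmf q"
      then have "0 \<le> k + x" using q Suc.prems False by fastforce
      then show "first_passage_prob q (k + x + 1) m =
          (\<Sum>i\<le>m. first_passage_prob q (k + x) i * first_passage_prob q 1 (m - i))"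
        by (rule Suc.IH)
    qed
    also have "\<dots> = (\<Sum>i\<le>m. first_passage_prob q k (Suc i) * first_passage_prob q 1 (m - i))"
      using False by (simp add: nn_integral_sum nn_integral_multc first_passage_prob_Suc)
    also have "\<dots> = (\<Sum>i\<le>Suc m. first_passage_prob q k i * first_passage_prob q 1 (Suc m - i))"
      using False by (subst sum.atMost_Suc_shift) simp
    finally show ?thesis .
  qed
qed

text \<open>By the convolution identity, the total masses of the hitting time laws are the powers of the
  total mass at level 1.\<close>

lemma suminf_first_passage_prob:
  assumes q: "set_pmf q \<subseteq> {-1..}" and one: "(\<Sum>n. first_passage_prob q 1 n) = 1"
  shows "(\<Sum>n. first_passage_prob q (int k) n) = 1"
proof (induction k)
  case 0
  have "(\<Sum>n. first_passage_prob q 0 n) = (\<Sum>n\<in>{0}. first_passage_prob q 0 n)"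
  proof (rule suminf_finite)
    show "first_passage_prob q 0 n = 0" if "n \<notin> {0}" for n
      using that by (cases n) (simp_all add: first_passage_prob_Suc)
  qed simp
  then show ?case by simp
next
  case (Suc k)
  have "(\<Sum>n. first_passage_prob q (int k + 1) n) =
        (\<Sum>n. first_passage_prob q (int k) n) * (\<Sum>n. first_passage_prob q 1 n)"
    by (simp add: first_passage_prob_add_one[OF q] suminf_convolution_ennreal)
  with Suc one show ?case
    by (simp add: add.commute)
qed

section \<open>The normalised sum at the first passage\<close>

text \<open>The contribution of \<open>T\<^sub>p = m + 1\<close> to the expectation of the normalised sum. The formula
  for \<open>m + 1\<close> steps turns first passage at level \<open>p\<close> into the event that the sum is \<open>-p\<close>; once
  the first step \<open>x\<close> is split off, the formula for \<open>m\<close> steps turns it back into first passage, now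
  at level \<open>p + x\<close>. The two applications together produce the factor \<open>m * p / (p + x)\<close>.\<close>

lemma first_passage_average_at:
  fixes g :: "int \<Rightarrow> ennreal" and p :: nat
  assumes q: "set_pmf q \<subseteq> {-1..}" and p: "p \<ge> 2"
  shows "1 / (of_nat (Suc m) - 1) *
      (\<integral>\<^sup>+xs. sum_list (map g xs) * of_bool (first_passage (int p) xs) \<partial>replicate_pmf (Suc m) q) =
    (\<integral>\<^sup>+x. g x * ennreal (real p / (real p + of_int x)) * first_passage_prob q (int p + x) m \<partial>q)"
    (is "1 / (of_nat (Suc m) - 1) * ?L = ?R")
proof -
  let ?N = "\<lambda>x. \<integral>\<^sup>+xs. of_bool (sum_list xs = - (int p + x)) \<partial>replicate_pmf m q"
  have "of_nat (Suc m) * ?L =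
      ennreal (of_int (int p)) * (\<integral>\<^sup>+xs. sum_list (map g xs) * of_bool (sum_list xs = - int p) \<partial>replicate_pmf (Suc m) q)"
    using first_passage_ballot[OF q, of "int p" "Suc m" "\<lambda>N. sum_mset (image_mset g N)"]
    by (simp add: sum_mset_sum_list flip: mset_map del: replicate_pmf.simps)
  also have "(\<integral>\<^sup>+xs. sum_list (map g xs) * of_bool (sum_list xs = - int p) \<partial>replicate_pmf (Suc m) q) =
      of_nat (Suc m) * (\<integral>\<^sup>+x. \<integral>\<^sup>+xs. g x * of_bool (x + sum_list xs = - int p) \<partial>replicate_pmf m q \<partial>q)"
    using nn_integral_replicate_pmf_exchangeable[where n = m and g = g and q = q and
        G = "\<lambda>N. of_bool (sum_mset N = - int p)"]
    by (simp add: sum_mset_sum_list del: replicate_pmf.simps)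
  also have "(\<integral>\<^sup>+x. \<integral>\<^sup>+xs. g x * of_bool (x + sum_list xs = - int p) \<partial>replicate_pmf m q \<partial>q) =
      (\<integral>\<^sup>+x. g x * ?N x \<partial>q)"
  proof -
    have "x + s = - int p \<longleftrightarrow> s = - (int p + x)" for x s by auto
    then show ?thesis
      by (simp add: nn_integral_cmult)
  qed
  finally have "of_nat (Suc m) * ?L = of_nat (Suc m) * (of_nat p * (\<integral>\<^sup>+x. g x * ?N x \<partial>q))"
    by (simp add: mult.left_commute ennreal_of_nat_eq_real_of_nat del: of_nat_Suc)
  then have L: "?L = of_nat p * (\<integral>\<^sup>+x. g x * ?N x \<partial>q)"
    by (simp add: ennreal_mult_cancel_left del: replicate_pmf.simps of_nat_Suc)
  have pos: "real p + of_int x > 0" "int p + x > 0" if "x \<in> set_pmf q" for x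
    using that q p by force+
  show ?thesis
  proof (cases "m = 0")
    case True
    (* The prefactor is infinite here; both sides vanish because no steps cannot descend p + x > 0 levels. *)
    have "?N x = 0" if "x \<in> set_pmf q" for x
      using pos[OF that] True by simp
    then have "(\<integral>\<^sup>+x. g x * ?N x \<partial>q) = (\<integral>\<^sup>+x. 0 \<partial>q)"
      by (intro nn_integral_cong_AE AE_pmfI) simp
    moreover have "?R = (\<integral>\<^sup>+x. 0 \<partial>q)"
    proof (intro nn_integral_cong_AE AE_pmfI)
      fix x assume "x \<in> set_pmf q"
      from pos(2)[OF this] show "g x * ennreal (real p / (real p + of_int x)) * first_passage_prob q (int p + x) m = 0"
        using True by simp
    qed
    ultimately show ?thesis
      unfolding L by simp
  next
    case m: False
    have "?N x = ennreal (real m / (real p + of_int x)) * first_passage_prob q (int p + x) m"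
      if x: "x \<in> set_pmf q" for x
    proof -
      let ?r = "real p + of_int x"
      have "ennreal (inverse ?r) * (of_nat m * first_passage_prob q (int p + x) m) =
          ennreal (inverse ?r) * (ennreal ?r * ?N x)"
        using first_passage_ballot[OF q, of "int p + x" m "\<lambda>_. 1"] pos[OF x]
        by (simp add: first_passage_prob_def)
      also have "\<dots> = ennreal (inverse ?r * ?r) * ?N x"
        using pos[OF x] by (subst ennreal_mult) (auto simp: mult.assoc)
      also have "inverse ?r * ?r = 1"
        using pos[OF x] by simp
      finally have "?N x = ennreal (inverse ?r) * of_nat m * first_passage_prob q (int p + x) m"
        by (simp add: mult.assoc)
      also have "ennreal (inverse ?r) * of_nat m = ennreal (inverse ?r * real m)"
        using pos[OF x] by (simp add: ennreal_mult ennreal_of_nat_eq_real_of_nat)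
      also have "inverse ?r * real m = real m / ?r"
        by (simp add: divide_inverse mult.commute)
      finally show ?thesis .
    qed
    then have "(\<integral>\<^sup>+x. g x * ?N x \<partial>q) = (\<integral>\<^sup>+x. g x * (ennreal (real m / (real p + of_int x)) * first_passage_prob q (int p + x) m) \<partial>q)"
      by (intro nn_integral_cong_AE AE_pmfI) (simp only:)
    then have "1 / (of_nat (Suc m) - 1) * ?L =
        (\<integral>\<^sup>+x. 1 / of_nat m * (of_nat p * (g x * (ennreal (real m / (real p + of_int x)) * first_passage_prob q (int p + x) m))) \<partial>q)"
      unfolding L by (simp add: nn_integral_cmult)
    also have "\<dots> = ?R"
    proof (intro nn_integral_cong_AE AE_pmfI)
      fix x assume x: "x \<in> set_pmf q"
      have "1 / of_nat m * (of_nat p * ennreal (real m / (real p + of_int x))) =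
            ennreal (1 / real m * (real p * (real m / (real p + of_int x))))"
        using m pos[OF x] divide_ennreal[of 1 "real m"]
        by (simp add: ennreal_mult ennreal_of_nat_eq_real_of_nat
            del: times_divide_eq_left times_divide_eq_right)
      also have "1 / real m * (real p * (real m / (real p + of_int x))) = real p / (real p + of_int x)"
        using m by simp
      finally have coeff: "1 / of_nat m * (of_nat p * ennreal (real m / (real p + of_int x))) =
          ennreal (real p / (real p + of_int x))" .
      show "1 / of_nat m * (of_nat p * (g x * (ennreal (real m / (real p + of_int x)) * first_passage_prob q (int p + x) m))) =
          g x * ennreal (real p / (real p + of_int x)) * first_passage_prob q (int p + x) m"
        unfolding coeff[symmetric] by (simp only: mult.assoc mult.commute mult.left_commute)
    qed
    finally show ?thesis .
  qed
qed

lemma first_passage_average: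
  fixes g :: "int \<Rightarrow> ennreal" and p :: nat
  assumes q: "set_pmf q \<subseteq> {-1..}" and p: "p \<ge> 2"
    and one: "(\<Sum>n. first_passage_prob q 1 n) = 1"
  shows "(\<Sum>n. 1 / (of_nat n - 1) *
      (\<integral>\<^sup>+xs. sum_list (map g xs) * of_bool (first_passage (int p) xs) \<partial>replicate_pmf n q)) =
    (\<integral>\<^sup>+x. g x * ennreal (real p / (real p + of_int x)) \<partial>q)"
    (is "(\<Sum>n. ?t n) = _")
proof -
  have "(\<Sum>n. ?t n) = (\<Sum>m. ?t (m + 1)) + (\<Sum>n<1. ?t n)"
    by (rule suminf_offset) simp
  also have "(\<Sum>n<1. ?t n) = 0"
    using p by simp
  also have "(\<Sum>m. ?t (m + 1)) =
      (\<Sum>m. \<integral>\<^sup>+x. g x * ennreal (real p / (real p + of_int x)) * first_passage_prob q (int p + x) m \<partial>q)"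
    unfolding Suc_eq_plus1[symmetric] first_passage_average_at[OF q p] ..
  also have "\<dots> = (\<integral>\<^sup>+x. g x * ennreal (real p / (real p + of_int x)) * (\<Sum>m. first_passage_prob q (int p + x) m) \<partial>q)"
    by (subst nn_integral_suminf[symmetric]) simp_all
  also have "\<dots> = (\<integral>\<^sup>+x. g x * ennreal (real p / (real p + of_int x)) \<partial>q)"
  proof (intro nn_integral_cong_AE AE_pmfI)
    fix x assume "x \<in> set_pmf q"
    then have "int p + x = int (nat (int p + x))" using q p by fastforce
    then have "(\<Sum>m. first_passage_prob q (int p + x) m) = 1"
      using suminf_first_passage_prob[OF q one] by metis
    then show "g x * ennreal (real p / (real p + of_int x)) * (\<Sum>m. first_passage_prob q (int p + x) m) =
        g x * ennreal (real p / (real p + of_int x))"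
      by simp
  qed
  finally show ?thesis by simp
qed

section \<open>From the random walk to lists of steps\<close>

definition increments :: "(nat \<Rightarrow> 'a \<Rightarrow> int) \<Rightarrow> nat \<Rightarrow> 'a \<Rightarrow> int list" where
  "increments X n \<omega> = map (\<lambda>i. X i \<omega>) [1..<Suc n]"

lemma length_increments [simp]: "length (increments X n \<omega>) = n"
  by (simp add: increments_def del: upt_Suc)

lemma sum_list_increments: "sum_list (increments X n \<omega>) = walk X n \<omega>"
  unfolding walk_def increments_def
  by (simp only: sum_list_distinct_conv_sum_set distinct_upt set_upt atLeastLessThanSuc_atLeastAtMost)

lemma hitting_time_eq_enat_iff:
  "hitting_time X p \<omega> = enat n \<longleftrightarrow> first_passage (int p) (increments X n \<omega>)"
proof -
  let ?A = "{k. walk X k \<omega> = - int p}"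
  have "hitting_time X p \<omega> = enat n \<longleftrightarrow> n \<in> ?A \<and> (\<forall>j<n. j \<notin> ?A)"
  proof
    assume h: "hitting_time X p \<omega> = enat n"
    then have "?A \<noteq> {}"
      unfolding hitting_time_def by (metis Inf_empty enat.distinct(1) image_empty top_enat_def)
    then have "hitting_time X p \<omega> \<in> enat ` ?A"
      unfolding hitting_time_def by (metis (no_types, lifting) all_not_in_conv image_is_empty wellorder_InfI)
    moreover have "enat n \<le> enat j" if "j \<in> ?A" for j
      using that unfolding h[symmetric] hitting_time_def by (intro INF_lower)
    ultimately show "n \<in> ?A \<and> (\<forall>j<n. j \<notin> ?A)"
      unfolding h by force
  next
    assume "n \<in> ?A \<and> (\<forall>j<n. j \<notin> ?A)"
    then show "hitting_time X p \<omega> = enat n"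
      unfolding hitting_time_def
      by (intro antisym INF_lower2[of n] INF_greatest) (auto simp: not_less[symmetric])
  qed
  moreover have "take j (increments X n \<omega>) = increments X j \<omega>" if "j < n" for j
    using that by (simp add: increments_def take_map take_upt del: upt_Suc)
  ultimately show ?thesis
    unfolding first_passage_iff by (auto simp: sum_list_increments)
qed

text \<open>The identity is pointwise and includes \<open>T = \<infinity>\<close>, where the left-hand side is 0 by convention
  and no term of the series contributes.\<close>

lemma hitting_average_eq_suminf:
  "hitting_average X f p \<omega> =
     (\<Sum>n. 1 / (of_nat n - 1) *
        (sum_list (map (\<lambda>x. ennreal (f x)) (increments X n \<omega>)) * of_bool (first_passage (int p) (increments X n \<omega>))))"
    (is "_ = (\<Sum>n. ?t n)")
proof (cases "hitting_time X p \<omega>")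
  case (enat N)
  have "(\<Sum>n. ?t n) = (\<Sum>n\<in>{N}. ?t n)"
    by (rule suminf_finite) (simp_all add: enat flip: hitting_time_eq_enat_iff)
  also have "\<dots> = 1 / (of_nat N - 1) * sum_list (map (\<lambda>x. ennreal (f x)) (increments X N \<omega>))"
    by (simp add: enat flip: hitting_time_eq_enat_iff)
  also have "sum_list (map (\<lambda>x. ennreal (f x)) (increments X N \<omega>)) = (\<Sum>i | 1 \<le> i \<and> i \<le> N. ennreal (f (X i \<omega>)))"
    by (simp add: increments_def sum_list_distinct_conv_sum_set comp_def atLeastLessThanSuc_atLeastAtMost del: upt_Suc)
       (simp add: atLeastAtMost_def atLeast_def atMost_def Collect_conj_eq)
  finally show ?thesis
    by (simp add: hitting_average_def enat)
next
  case infinity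
  then have "\<not> first_passage (int p) (increments X n \<omega>)" for n
    by (simp flip: hitting_time_eq_enat_iff)
  then show ?thesis
    using infinity by (simp add: hitting_average_def)
qed

lemma (in prob_space) ex_pmf_of_count_space_rv:
  fixes Y :: "'a \<Rightarrow> 'b :: countable"
  assumes Y: "Y \<in> measurable M (count_space UNIV)"
  shows "\<exists>q. measure_pmf q = distr M (count_space UNIV) Y"
proof -
  interpret D: prob_space "distr M (count_space UNIV) Y"
    by (rule prob_space_distr[OF Y])
  have "AE x in distr M (count_space UNIV) Y. measure (distr M (count_space UNIV) Y) {x} \<noteq> 0"
    by (subst D.AE_support_countable) (auto intro!: exI[of _ UNIV])
  then have "measure_pmf (Abs_pmf (distr M (count_space UNIV) Y)) = distr M (count_space UNIV) Y"
    by (intro Abs_pmf_inverse) (auto intro: D.prob_space_axioms)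
  then show ?thesis by blast
qed

lemma measurable_increments:
  assumes "\<And>i. i \<ge> 1 \<Longrightarrow> X i \<in> measurable M (count_space UNIV)"
  shows "increments X n \<in> measurable M (count_space UNIV)"
proof -
  have "(\<lambda>\<omega>. map (\<lambda>i. X i \<omega>) is) \<in> measurable M (count_space UNIV)" if "set is \<subseteq> {1..}" for "is"
    using that
  proof (induction "is")
    case (Cons i "is")
    then have [measurable]: "X i \<in> measurable M (count_space UNIV)"
      "(\<lambda>\<omega>. map (\<lambda>i. X i \<omega>) is) \<in> measurable M (count_space UNIV)"
      using assms by auto
    have "(\<lambda>\<omega>. (\<lambda>x \<omega>. x # map (\<lambda>i. X i \<omega>) is) (X i \<omega>) \<omega>) \<in> measurable M (count_space UNIV)"
      by (rule measurable_compose_countable) measurable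
    then show ?case by simp
  qed simp
  from this[of "[1..<Suc n]"] show ?thesis
    unfolding increments_def by (simp add: subset_eq del: upt_Suc)
qed

lemma pmf_replicate_pmf:
  fixes q :: "'b pmf"
  shows "pmf (replicate_pmf (length xs) q) xs = prod_list (map (pmf q) xs)"
proof (induction xs)
  case (Cons x xs)
  have "replicate_pmf (Suc (length xs)) q = map_pmf (\<lambda>(x, xs). x # xs) (pair_pmf q (replicate_pmf (length xs) q))"
    by (simp add: pair_pmf_def map_pmf_def bind_assoc_pmf bind_return_pmf)
  moreover have "pmf (map_pmf (\<lambda>(x, xs). x # xs) (pair_pmf q (replicate_pmf (length xs) q))) (x # xs) =
      pmf (pair_pmf q (replicate_pmf (length xs) q)) (x, xs)"
    using pmf_map_inj'[of "\<lambda>(x, xs). x # xs" "pair_pmf q (replicate_pmf (length xs) q)" "(x, xs)"]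
    by (auto simp: inj_on_def)
  ultimately show ?case
    using Cons by (simp add: pmf_pair del: replicate_pmf.simps)
qed simp

lemma (in prob_space) distr_increments:
  assumes indep: "indep_vars (\<lambda>_. count_space UNIV) X {1..}"
    and q: "\<And>i. i \<ge> 1 \<Longrightarrow> distr M (count_space UNIV) (X i) = measure_pmf q"
  shows "distr M (count_space UNIV) (increments X n) = measure_pmf (replicate_pmf n q)"
proof -
  have X: "X i \<in> measurable M (count_space UNIV)" if "i \<ge> 1" for i
    using indep that by (auto simp: indep_vars_def)
  note increments = measurable_increments[of X M n, OF X]
  interpret D: prob_space "distr M (count_space UNIV) (increments X n)"
    by (rule prob_space_distr[OF increments])
  have single: "prob (X i -` {x} \<inter> space M) = pmf q x" if "i \<ge> 1" for i x
  proof -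
    have "pmf q x = measure (distr M (count_space UNIV) (X i)) {x}"
      by (simp add: q[OF that] measure_pmf_single)
    then show ?thesis
      using X[OF that] by (simp add: measure_distr)
  qed
  show ?thesis
  proof (rule measure_eqI_countable[of _ UNIV])
    fix xs :: "int list"
    show "emeasure (distr M (count_space UNIV) (increments X n)) {xs} = emeasure (measure_pmf (replicate_pmf n q)) {xs}"
    proof (cases "length xs = n")
      case False
      then have "increments X n -` {xs} = {}" by auto
      moreover have "xs \<notin> set_pmf (replicate_pmf n q)"
        using False by (simp add: set_replicate_pmf)
      ultimately show ?thesis
        using increments by (simp add: emeasure_distr emeasure_pmf_single set_pmf_iff)
    next
      case len: True
      have "prob (increments X n -` {xs} \<inter> space M) = pmf (replicate_pmf n q) xs"
      proof (cases "n = 0")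
        case True
        moreover have "increments X 0 -` {[]} = UNIV"
          by (auto simp: increments_def)
        ultimately show ?thesis
          using len by (simp add: prob_space)
      next
        case False
        have "increments X n \<omega> = xs \<longleftrightarrow> (\<forall>i\<in>{1..n}. X i \<omega> = xs ! (i - 1))" for \<omega>
        proof -
          have "increments X n \<omega> = xs \<longleftrightarrow> (\<forall>j<n. X (Suc j) \<omega> = xs ! j)"
            using len by (auto simp: increments_def list_eq_iff_nth_eq simp del: upt_Suc)
          also have "\<dots> \<longleftrightarrow> (\<forall>i\<in>{1..n}. X i \<omega> = xs ! (i - 1))"
            by (metis One_nat_def Suc_pred' atLeastAtMost_iff diff_Suc_1 le_add1 less_eq_Suc_le plus_1_eq_Suc)
          finally show ?thesis .
        qed
        then have "increments X n -` {xs} \<inter> space M = (\<Inter>i\<in>{1..n}. X i -` {xs ! (i - 1)} \<inter> space M)"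
          using False by auto
        also have "prob \<dots> = (\<Prod>i\<in>{1..n}. prob (X i -` {xs ! (i - 1)} \<inter> space M))"
          using False by (intro indep_varsD[OF indep]) auto
        also have "\<dots> = (\<Prod>i\<in>{1..n}. pmf q (xs ! (i - 1)))"
          by (intro prod.cong) (auto simp: single)
        also have "\<dots> = (\<Prod>j<n. pmf q (xs ! j))"
          by (rule prod.reindex_bij_witness[of _ Suc "\<lambda>i. i - 1"]) auto
        also have "\<dots> = pmf (replicate_pmf n q) xs"
          using len pmf_replicate_pmf[of xs q] by (simp add: prod.list_conv_set_nth atLeast0LessThan)
        finally show ?thesis .
      qed
      then show ?thesis
        using increments by (simp add: emeasure_distr emeasure_pmf_single emeasure_eq_measure)
    qed
  qed auto
qed

section \<open>The expectation of the normalised sum\<close>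

theorem theorem2:
  fixes M :: "'a measure" and X :: "nat \<Rightarrow> 'a \<Rightarrow> int" and f :: "int \<Rightarrow> real" and p :: nat
  assumes "prob_space M"
    and "iid M X"
    and "\<And>i \<omega>. i \<ge> 1 \<Longrightarrow> \<omega> \<in> space M \<Longrightarrow> X i \<omega> \<ge> -1"
    and "AE \<omega> in M. hitting_time X 1 \<omega> < \<infinity>"
    and "f \<in> borel_measurable (count_space UNIV)"
    and "\<And>x. f x \<ge> 0"
    and "p \<ge> 2"
  shows "(\<integral>\<^sup>+\<omega>. hitting_average X f p \<omega> \<partial>M) =
         (\<integral>\<^sup>+\<omega>. ennreal (f (X 1 \<omega>) * (real p / (real p + real_of_int (X 1 \<omega>)))) \<partial>M)"
proof -
  interpret prob_space M by fact
  have indep: "indep_vars (\<lambda>_. count_space UNIV) X {1..}"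
    and same: "\<And>i. i \<ge> 1 \<Longrightarrow> distr M (count_space UNIV) (X i) = distr M (count_space UNIV) (X 1)"
    using assms(2) unfolding iid_def by blast+
  have X: "X i \<in> measurable M (count_space UNIV)" if "i \<ge> 1" for i
    using indep that by (auto simp: indep_vars_def)
  obtain q where q1: "measure_pmf q = distr M (count_space UNIV) (X 1)"
    using ex_pmf_of_count_space_rv[OF X[of 1]] by auto
  have q: "set_pmf q \<subseteq> {-1..}"
  proof -
    have "AE x in distr M (count_space UNIV) (X 1). x \<ge> -1"
      using assms(3)[of 1] X[of 1] by (subst AE_distr_iff) auto
    then show ?thesis
      unfolding q1[symmetric] by (auto simp: AE_measure_pmf_iff)
  qed
  have integral_increments: "(\<integral>\<^sup>+\<omega>. F (increments X n \<omega>) \<partial>M) = (\<integral>\<^sup>+xs. F xs \<partial>replicate_pmf n q)"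
    for F :: "int list \<Rightarrow> ennreal" and n
  proof -
    have "measure_pmf (replicate_pmf n q) = distr M (count_space UNIV) (increments X n)"
      using distr_increments[OF indep] same[folded q1] by metis
    then show ?thesis
      using measurable_increments[where n = n, OF X] by (simp add: nn_integral_distr)
  qed
  have measurable_F_increments [measurable]: "(\<lambda>\<omega>. F (increments X n \<omega>)) \<in> borel_measurable M"
    for F :: "int list \<Rightarrow> ennreal" and n
    by (rule measurable_compose[OF measurable_increments[OF X]]) auto
  have one: "(\<Sum>n. first_passage_prob q 1 n) = 1"
  proof -
    (* The events that the hitting time is n partition an event of probability 1. *)
    have "(\<Sum>n. first_passage_prob q 1 n) =
        (\<Sum>n. \<integral>\<^sup>+\<omega>. of_bool (first_passage 1 (increments X n \<omega>)) \<partial>M)"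
      by (simp add: first_passage_prob_def integral_increments[of "\<lambda>xs. of_bool (first_passage 1 xs)"])
    also have "\<dots> = (\<integral>\<^sup>+\<omega>. (\<Sum>n. of_bool (first_passage 1 (increments X n \<omega>))) \<partial>M)"
      by (rule nn_integral_suminf[symmetric])
         (rule measurable_F_increments[of "\<lambda>xs. of_bool (first_passage 1 xs)"])
    also have "\<dots> = (\<integral>\<^sup>+\<omega>. 1 \<partial>M)"
    proof (rule nn_integral_cong_AE)
      show "AE \<omega> in M. (\<Sum>n. of_bool (first_passage 1 (increments X n \<omega>))) = (1 :: ennreal)"
        using assms(4)
      proof eventually_elim
        case (elim \<omega>)
        then obtain N where N: "hitting_time X 1 \<omega> = enat N" by auto
        have fp: "first_passage 1 (increments X n \<omega>) \<longleftrightarrow> n = N" for n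
          using hitting_time_eq_enat_iff[of X 1 \<omega> n] N by auto
        have "(\<Sum>n. of_bool (n = N)) = (\<Sum>n\<in>{N}. of_bool (n = N) :: ennreal)"
          by (rule suminf_finite) auto
        then show ?case unfolding fp by simp
      qed
    qed
    finally show ?thesis by (simp add: emeasure_space_1)
  qed
  let ?F = "\<lambda>xs. sum_list (map (\<lambda>x. ennreal (f x)) xs) * of_bool (first_passage (int p) xs)"
  have "(\<integral>\<^sup>+\<omega>. hitting_average X f p \<omega> \<partial>M) =
      (\<Sum>n. \<integral>\<^sup>+\<omega>. 1 / (of_nat n - 1) * ?F (increments X n \<omega>) \<partial>M)"
    unfolding hitting_average_eq_suminf
    by (rule nn_integral_suminf)
       (intro borel_measurable_times_ennreal borel_measurable_const measurable_F_increments)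
  also have "\<dots> = (\<Sum>n. 1 / (of_nat n - 1) * (\<integral>\<^sup>+\<omega>. ?F (increments X n \<omega>) \<partial>M))"
    by (intro suminf_cong nn_integral_cmult measurable_F_increments[of ?F])
  also have "\<dots> = (\<Sum>n. 1 / (of_nat n - 1) * (\<integral>\<^sup>+xs. ?F xs \<partial>replicate_pmf n q))"
    unfolding integral_increments[of ?F] ..
  also have "\<dots> = (\<integral>\<^sup>+x. ennreal (f x) * ennreal (real p / (real p + of_int x)) \<partial>q)"
    by (rule first_passage_average[OF q assms(7) one])
  also have "\<dots> = (\<integral>\<^sup>+x. ennreal (f x * (real p / (real p + of_int x))) \<partial>q)"
    by (intro nn_integral_cong) (simp only: ennreal_mult'[OF assms(6)])
  also have "\<dots> = (\<integral>\<^sup>+\<omega>. ennreal (f (X 1 \<omega>) * (real p / (real p + of_int (X 1 \<omega>)))) \<partial>M)"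
    unfolding q1 by (rule nn_integral_distr) (auto intro: X)
  finally show ?thesis .
qed

end
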